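(* Let $R$ be a ring of prime characteristic $p>0$ and let $e\geq 1$ be an integer. Assume that $R$ has a $p$-basis over a subring $k\subset R$. Then the following properties are equivalent: 1. $R$ has a $p^e$-basis over $k$. 2. $R$ has a $p^s$-basis over $k$ for all integers $1\le s\leq e$. 3. $\mathrm{Der}_k(R)=\mathrm{IDer}_k(R;p^e-1)$. 4. $\mathrm{HS}_k(R;m)=\mathrm{IHS}_k(R;m;p^e-1)$ for all integers $1\le m\leq p^e-1$.
   Context: Rings are commutative with unit. Let $R$ be a ring of prime characteristic $p$ and $k\subset R$ a subring. $p^e$-basis: for $e\ge 1$, $R^{p^e}=\{r^{p^e}\mid r\in R\}$, and $R^{p^e}[k]$ is the subring of $R$ generated by $R^{p^e}$ and $k$. A subset $B\subset R$ (possibly infinite) is $p^e$-independent over $k$ if the family of monomials $B_e=\{b_1^{\alpha_1}\cdots b_m^{\alpha_m}\mid b_i\in B,\ b_i\neq b_j \text{ for } i\ne j,\ 0\leq \alpha_i<p^e\}$ (indexed by the finitely supported exponent functions) is linearly independent over $R^{p^e}[k]$. It is a $p^e$-basis of $R$ over $k$ if it is $p^e$-independent over $k$ and $R=R^{p^e}[k][B]$. A $p$-basis is the case $e=1$. Hasse-Schmidt derivations: for $m\in\mathbb{N}\cup\{\infty\}$, $m\ge1$, an HS-derivation of $R$ over $k$ of length $m$ is a sequence $D=(D_0,D_1,\ldots,D_m)$ (infinite sequence if $m=\infty$) of $k$-linear maps $D_\alpha:R\to R$ with $D_0=\mathrm{Id}_R$ and $D_\alpha(xy)=\sum_{i+j=\alpha}D_i(x)D_j(y)$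 for all $x,y\in R$ and all $\alpha$. The set of these is $\mathrm{HS}_k(R;m)$. For $m\le n\leq\infty$, $\mathrm{IHS}_k(R;m;n)$ is the set of $D\in \mathrm{HS}_k(R;m)$ that are $n$-integrable, i.e. for which there is $E\in\mathrm{HS}_k(R;n)$ whose truncation to length $m$ is $D$. $\mathrm{Der}_k(R)$ is the module of $k$-derivations $R\to R$, and $\mathrm{IDer}_k(R;n)$ is the set of $\delta\in\mathrm{Der}_k(R)$ for which there is $D\in\mathrm{HS}_k(R;n)$ with $D_1=\delta$. *)

theory Defs
  imports
    "HOL-Computational_Algebra.Primes"
    "HOL-Library.Poly_Mapping"
    "HOL-Library.Extended_Nat"
    "HOL-Library.FuncSet"
begin

text \<open>The ambient ring \<open>R\<close> is a type \<open>'a::comm_ring_1\<close>; subrings are subsets of it.\<close>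

definition is_subring :: "'a::comm_ring_1 set \<Rightarrow> bool" where
  "is_subring S \<longleftrightarrow> 1 \<in> S \<and> (\<forall>x\<in>S. \<forall>y\<in>S. x - y \<in> S \<and> x * y \<in> S)"

definition pow_subring :: "nat \<Rightarrow> nat \<Rightarrow> 'a::comm_ring_1 set \<Rightarrow> 'a set" where
  "pow_subring p e K = is_subring hull (range (\<lambda>r. r ^ (p ^ e)) \<union> K)"

text \<open>Exponent functions are finitely supported maps from ring elements to naturals, with support in
  \<open>B\<close>. Independence concerns the family of monomials indexed by these functions, so
  different exponent functions giving the same ring element already violate it.\<close>

definition reduced_exponents :: "nat \<Rightarrow> nat \<Rightarrow> 'a set \<Rightarrow> ('a \<Rightarrow>\<^sub>0 nat) set" where
  "reduced_exponents p e B = {\<alpha>. Poly_Mapping.keys \<alpha> \<subseteq> B \<and> (\<forall>b. Poly_Mapping.lookup \<alpha> b < p ^ e)}"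

definition monomial_value :: "('a::comm_ring_1 \<Rightarrow>\<^sub>0 nat) \<Rightarrow> 'a" where
  "monomial_value \<alpha> = (\<Prod>b\<in>Poly_Mapping.keys \<alpha>. b ^ Poly_Mapping.lookup \<alpha> b)"

definition p_independent :: "nat \<Rightarrow> nat \<Rightarrow> 'a::comm_ring_1 set \<Rightarrow> 'a set \<Rightarrow> bool" where
  "p_independent p e K B \<longleftrightarrow>
     (\<forall>F c. finite F \<and> F \<subseteq> reduced_exponents p e B \<and> (\<forall>\<alpha>\<in>F. c \<alpha> \<in> pow_subring p e K)
            \<and> (\<Sum>\<alpha>\<in>F. c \<alpha> * monomial_value \<alpha>) = 0
        \<longrightarrow> (\<forall>\<alpha>\<in>F. c \<alpha> = 0))"

definition p_basis :: "nat \<Rightarrow> nat \<Rightarrow> 'a::comm_ring_1 set \<Rightarrow> 'a set \<Rightarrow> bool" where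
  "p_basis p e K B \<longleftrightarrow>
     p_independent p e K B \<and> is_subring hull (pow_subring p e K \<union> B) = UNIV"

definition linear_over :: "'a::comm_ring_1 set \<Rightarrow> ('a \<Rightarrow> 'a) \<Rightarrow> bool" where
  "linear_over K f \<longleftrightarrow>
     (\<forall>x y. f (x + y) = f x + f y) \<and> (\<forall>c\<in>K. \<forall>x. f (c * x) = c * f x)"

text \<open>A sequence of length \<open>m\<close> (possibly \<open>\<infinity>\<close>) is a function on \<open>nat\<close> that is
  \<open>extensional\<close> on the indices up to \<open>m\<close>, so that equality of functions is
  equality of sequences of that length.\<close>

definition HS :: "'a::comm_ring_1 set \<Rightarrow> enat \<Rightarrow> (nat \<Rightarrow> 'a \<Rightarrow> 'a) set" where
  "HS K m = {D \<in> extensional {\<alpha>. enat \<alpha> \<le> m}.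
     D 0 = id \<and>
     (\<forall>\<alpha>. enat \<alpha> \<le> m \<longrightarrow> linear_over K (D \<alpha>) \<and>
        (\<forall>x y. D \<alpha> (x * y) = (\<Sum>i\<le>\<alpha>. D i x * D (\<alpha> - i) y)))}"

definition truncation :: "enat \<Rightarrow> (nat \<Rightarrow> 'a \<Rightarrow> 'a) \<Rightarrow> nat \<Rightarrow> 'a \<Rightarrow> 'a" where
  "truncation m E = restrict E {\<alpha>. enat \<alpha> \<le> m}"

definition IHS :: "'a::comm_ring_1 set \<Rightarrow> enat \<Rightarrow> enat \<Rightarrow> (nat \<Rightarrow> 'a \<Rightarrow> 'a) set" where
  "IHS K m n = {D \<in> HS K m. \<exists>E\<in>HS K n. truncation m E = D}"

definition Der :: "'a::comm_ring_1 set \<Rightarrow> ('a \<Rightarrow> 'a) set" where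
  "Der K = {\<delta>. linear_over K \<delta> \<and> (\<forall>x y. \<delta> (x * y) = x * \<delta> y + \<delta> x * y)}"

definition IDer :: "'a::comm_ring_1 set \<Rightarrow> enat \<Rightarrow> ('a \<Rightarrow> 'a) set" where
  "IDer K n = {\<delta> \<in> Der K. \<exists>D\<in>HS K n. D 1 = \<delta>}"

end

theory Submission
  imports Defs "HOL-Computational_Algebra.Formal_Power_Series"
begin

text \<open>Write \<open>R\<^sub>e\<close> for \<open>pow_subring p e K\<close>. A Hasse-Schmidt derivation of length less than \<open>p^e\<close> is a
  homomorphism \<open>\<phi>\<close> from \<open>R\<close> to truncated power series with \<open>\<phi> x = x\<close> modulo \<open>t\<close>. It is \<open>R\<^sub>e\<close>-linear, because
  \<open>\<phi> (r^(p^e)) - r^(p^e) = (\<phi> r - r)^(p^e)\<close> is divisible by \<open>t^(p^e)\<close>. If \<open>B\<close> is a \<open>p^e\<close>-basis, a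
  homomorphism modulo \<open>t^(p^e)\<close> can be prescribed arbitrarily on \<open>B\<close> (with the right constant terms): the
  graph generated by \<open>R\<^sub>e\<close> and the prescribed series is spanned, modulo \<open>t^(p^e)\<close>, by reduced monomials,
  so independence makes it single-valued. Hence (1) implies (4), and (3) is the case \<open>m = 1\<close>.

  Conversely, a given \<open>p\<close>-basis \<open>B\<close> generates \<open>R\<close> over every \<open>R\<^sub>e\<close>. Let \<open>B\<close> be \<open>p^s\<close>-independent. A relation
  of level \<open>s + 1\<close> splits, by the residues of the exponents modulo \<open>q = p^s\<close>, into relations
  \<open>\<Sum> c r^q = 0\<close> with \<open>c\<close> in \<open>R\<^sub>s\<^sub>+\<^sub>1\<close> and \<open>r\<close> a monomial with exponents below \<open>p\<close>. If \<open>D\<close> integrates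
  \<open>\<delta>\<close>, the coefficient \<open>D_q\<close> maps such a relation to \<open>\<Sum> c (\<delta> r)^q = 0\<close>, and the derivations dual to \<open>B\<close>
  then kill every coefficient. So (3) makes the given \<open>p\<close>-basis a \<open>p^s\<close>-basis for all \<open>s \<le> e\<close>.\<close>

unbundle fps_syntax

subsection \<open>Subrings\<close>

lemma is_subring_hull [simp]: "is_subring (is_subring hull X)"
  by (rule hull_in) (auto simp: is_subring_def)

lemma
  assumes "is_subring S"
  shows is_subring_1: "1 \<in> S"
    and is_subring_0: "0 \<in> S"
    and is_subring_diff: "x \<in> S \<Longrightarrow> y \<in> S \<Longrightarrow> x - y \<in> S"
    and is_subring_mult: "x \<in> S \<Longrightarrow> y \<in> S \<Longrightarrow> x * y \<in> S"
    and is_subring_uminus: "x \<in> S \<Longrightarrow> - x \<in> S"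
    and is_subring_add: "x \<in> S \<Longrightarrow> y \<in> S \<Longrightarrow> x + y \<in> S"
proof -
  show 1: "1 \<in> S" and d: "x \<in> S \<Longrightarrow> y \<in> S \<Longrightarrow> x - y \<in> S" and "x \<in> S \<Longrightarrow> y \<in> S \<Longrightarrow> x * y \<in> S" for x y
    using assms by (auto simp: is_subring_def)
  show 0: "0 \<in> S" using d[OF 1 1] by simp
  show u: "- x \<in> S" if "x \<in> S" for x using d[OF 0 that] by simp
  show "x + y \<in> S" if "x \<in> S" "y \<in> S" for x y using d[OF that(1) u[OF that(2)]] by simp
qed

lemma is_subring_power: "is_subring S \<Longrightarrow> x \<in> S \<Longrightarrow> x ^ n \<in> S"
  by (induction n) (auto intro: is_subring_1 is_subring_mult)

lemma is_subring_of_nat: "is_subring S \<Longrightarrow> of_nat n \<in> S"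
  by (induction n) (auto intro: is_subring_1 is_subring_0 is_subring_add)

lemma is_subring_sum: "is_subring S \<Longrightarrow> (\<And>i. i \<in> I \<Longrightarrow> f i \<in> S) \<Longrightarrow> sum f I \<in> S"
  by (induction I rule: infinite_finite_induct) (auto intro: is_subring_0 is_subring_add)

lemma is_subring_pow_subring [simp]: "is_subring (pow_subring p e K)"
  by (simp add: pow_subring_def)

lemma power_in_pow_subring: "r ^ (p ^ e) \<in> pow_subring p e K"
  by (auto simp: pow_subring_def intro: hull_inc)

lemma subset_pow_subring: "K \<subseteq> pow_subring p e K"
  by (auto simp: pow_subring_def intro: hull_inc)

lemma pow_subring_antimono:
  assumes "s \<le> e"
  shows "pow_subring p e K \<subseteq> pow_subring p s K"
proof -
  have "r ^ (p ^ e) \<in> pow_subring p s K" for r :: 'a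
  proof -
    have "p ^ e = p ^ (e - s) * p ^ s" using assms by (simp flip: power_add)
    then show ?thesis using power_in_pow_subring[of "r ^ (p ^ (e - s))" p s K]
      by (simp flip: power_mult)
  qed
  then show ?thesis unfolding pow_subring_def[of p e]
    using subset_pow_subring[of K p s] by (intro hull_minimal) auto
qed

section \<open>Frobenius, and generation over smaller power subrings\<close>

lemma diff_power_prime_power:
  fixes x y :: "'b::comm_ring_1"
  assumes "prime CHAR('b)"
  shows "(x - y) ^ (CHAR('b) ^ e) = x ^ (CHAR('b) ^ e) - y ^ (CHAR('b) ^ e)"
  using freshmans_dream'[OF assms refl, of "x - y" y e] by (simp add: algebra_simps)

lemma is_subring_frobenius_preimage:
  fixes S :: "'b::comm_ring_1 set"
  assumes "prime CHAR('b)" "is_subring S"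
  shows "is_subring {r. r ^ (CHAR('b) ^ s) \<in> S}"
  using assms(2) unfolding is_subring_def[of "Collect _"]
  by (auto simp: diff_power_prime_power[OF assms(1)] power_mult_distrib
      intro: is_subring_1 is_subring_diff is_subring_mult)

text \<open>Write \<open>R\<^sub>s\<close> for \<open>pow_subring p s K\<close>. Raising
  \<open>R = R\<^sub>1[B]\<close> to the power \<open>p ^ s\<close> puts every
  \<open>r ^ (p ^ s)\<close> into \<open>R\<^sub>s\<^sub>+\<^sub>1[B]\<close>, since
  \<open>(r ^ p) ^ (p ^ s)\<close> is already a power of level \<open>s + 1\<close>. Hence
  \<open>R\<^sub>s\<close>, and with it \<open>R = R\<^sub>s[B]\<close>, lies in
  \<open>R\<^sub>s\<^sub>+\<^sub>1[B]\<close>.\<close>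

lemma hull_pow_subring_Suc:
  fixes K B :: "'a::comm_ring_1 set"
  assumes "prime p" "CHAR('a) = p"
    and 1: "is_subring hull (pow_subring p 1 K \<union> B) = UNIV"
    and s: "is_subring hull (pow_subring p s K \<union> B) = UNIV"
  shows "is_subring hull (pow_subring p (Suc s) K \<union> B) = UNIV"
proof -
  let ?U = "is_subring hull (pow_subring p (Suc s) K \<union> B)"
  let ?T = "{r. r ^ (p ^ s) \<in> ?U}"
  have T: "is_subring ?T"
    using is_subring_frobenius_preimage[of ?U s] assms by simp
  have K: "K \<subseteq> ?U" and B: "B \<subseteq> ?U"
    using subset_pow_subring by (auto intro!: hull_inc)
  have "r ^ p \<in> ?T" for r
    using power_in_pow_subring[of r p "Suc s" K] by (auto simp flip: power_mult intro: hull_inc)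
  moreover have "K \<subseteq> ?T" "B \<subseteq> ?T"
    using K B by (auto intro: is_subring_power)
  ultimately have "pow_subring p 1 K \<subseteq> ?T"
    unfolding pow_subring_def[of p 1] using T by (intro hull_minimal) auto
  then have "is_subring hull (pow_subring p 1 K \<union> B) \<subseteq> ?T"
    using \<open>B \<subseteq> ?T\<close> T by (intro hull_minimal) auto
  then have "r ^ (p ^ s) \<in> ?U" for r using 1 by auto
  then have "pow_subring p s K \<subseteq> ?U"
    unfolding pow_subring_def[of p s] using K by (intro hull_minimal) auto
  then have "is_subring hull (pow_subring p s K \<union> B) \<subseteq> ?U"
    using B by (intro hull_minimal) auto
  then show ?thesis using s by auto
qed

subsection \<open>Monomials\<close>

text \<open>The values \<open>f b\<close> are kept general so that one notion covers monomials in
  ring elements, in prescribed power series, and in the constant 2, which measures degree.\<close>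

definition mon :: "('a \<Rightarrow> 'b::comm_monoid_mult) \<Rightarrow> ('a \<Rightarrow>\<^sub>0 nat) \<Rightarrow> 'b" where
  "mon f \<alpha> = (\<Prod>b\<in>Poly_Mapping.keys \<alpha>. f b ^ Poly_Mapping.lookup \<alpha> b)"

lemma monomial_value_eq_mon: "monomial_value = mon (\<lambda>b. b)"
  by (simp add: fun_eq_iff monomial_value_def mon_def)

lemma mon_superset:
  assumes "finite S" "Poly_Mapping.keys \<alpha> \<subseteq> S"
  shows "mon f \<alpha> = (\<Prod>b\<in>S. f b ^ Poly_Mapping.lookup \<alpha> b)"
  unfolding mon_def using assms
  by (intro prod.mono_neutral_left) (auto simp: not_in_keys_iff_lookup_eq_zero)

lemma mon_0 [simp]: "mon f 0 = 1"
  by (simp add: mon_def)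

lemma mon_add: "mon f (\<alpha> + \<beta>) = mon f \<alpha> * mon f \<beta>"
proof -
  let ?S = "Poly_Mapping.keys \<alpha> \<union> Poly_Mapping.keys \<beta>"
  have "Poly_Mapping.keys (\<alpha> + \<beta>) \<subseteq> ?S" by (rule Poly_Mapping.keys_add)
  then show ?thesis
    by (simp add: mon_superset[of ?S] lookup_add power_add prod.distrib)
qed

lemma mon_single [simp]: "mon f (Poly_Mapping.single b n) = f b ^ n"
  by (cases "n = 0") (auto simp: mon_def)

lemma mon_nth_0: "mon f \<alpha> $ 0 = mon (\<lambda>b. f b $ 0) \<alpha>"
  for f :: "'a \<Rightarrow> 'b::comm_ring_1 fps"
proof -
  have "(\<Prod>b\<in>S. h b) $ 0 = (\<Prod>b\<in>S. h b $ 0)" for S and h :: "'a \<Rightarrow> 'b fps"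
    by (induction S rule: infinite_finite_induct) auto
  then show ?thesis by (simp add: mon_def fps_nth_power_0)
qed

lemma mon_cong: "(\<And>b. b \<in> Poly_Mapping.keys \<alpha> \<Longrightarrow> f b = g b) \<Longrightarrow> mon f \<alpha> = mon g \<alpha>"
  unfolding mon_def by (rule prod.cong) auto

subsection \<open>Power series modulo a power of the variable\<close>

definition cong_upto :: "nat \<Rightarrow> 'b::comm_ring_1 fps \<Rightarrow> 'b fps \<Rightarrow> bool" where
  "cong_upto M f g \<longleftrightarrow> (\<forall>i<M. f $ i = g $ i)"

lemma cong_upto_refl [simp]: "cong_upto M f f"
  by (simp add: cong_upto_def)

lemma cong_upto_sym: "cong_upto M f g \<Longrightarrow> cong_upto M g f"
  by (simp add: cong_upto_def)

lemma cong_upto_trans: "cong_upto M f g \<Longrightarrow> cong_upto M g h \<Longrightarrow> cong_upto M f h"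
  by (simp add: cong_upto_def)

lemma cong_upto_antimono: "cong_upto M f g \<Longrightarrow> M' \<le> M \<Longrightarrow> cong_upto M' f g"
  by (simp add: cong_upto_def)

lemma cong_upto_diff: "cong_upto M f f' \<Longrightarrow> cong_upto M g g' \<Longrightarrow> cong_upto M (f - g) (f' - g')"
  by (simp add: cong_upto_def)

lemma cong_upto_mult: "cong_upto M f f' \<Longrightarrow> cong_upto M g g' \<Longrightarrow> cong_upto M (f * g) (f' * g')"
  by (auto simp: cong_upto_def fps_mult_nth intro!: sum.cong)

lemma cong_upto_sum:
  "(\<And>i. i \<in> I \<Longrightarrow> cong_upto M (f i) (g i)) \<Longrightarrow> cong_upto M (sum f I) (sum g I)"
  by (auto simp: cong_upto_def fps_sum_nth intro: sum.cong)

text \<open>By additivity of Frobenius the difference is the power of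
  \<open>f - fps_const a\<close>, a series without constant term, so its order is at least the
  exponent.\<close>

lemma cong_upto_frobenius:
  fixes f :: "'b::comm_ring_1 fps"
  assumes "prime CHAR('b)" "f $ 0 = a"
  shows "cong_upto (CHAR('b) ^ e) (f ^ (CHAR('b) ^ e)) (fps_const (a ^ (CHAR('b) ^ e)))"
proof -
  have "((f - fps_const a) ^ (CHAR('b) ^ e)) $ i = 0" if "i < CHAR('b) ^ e" for i
    using startsby_zero_power_prefix[of "f - fps_const a"] that assms(2) by auto
  then show ?thesis
    using diff_power_prime_power[of f "fps_const a" e] assms(1)
    by (auto simp: cong_upto_def fps_const_power)
qed

text \<open>Removing the constant term of \<open>f\<close> changes \<open>f ^ q\<close> only at
  index 0. What remains is the lowest coefficient of the \<open>q\<close>-th power of a series that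
  starts at index 1.\<close>

lemma frobenius_nth:
  fixes f :: "'b::comm_ring_1 fps"
  assumes "prime CHAR('b)" and q: "q = CHAR('b) ^ e"
  shows "(f ^ q) $ q = (f $ 1) ^ q"
proof -
  have "q > 0" using assms by (simp add: prime_gt_0_nat)
  have "(f ^ q) $ q = ((f - fps_const (f $ 0)) ^ q) $ q"
    using diff_power_prime_power[of f "fps_const (f $ 0)" e] assms(1) \<open>q > 0\<close>
    by (simp add: q fps_const_power)
  also have "\<dots> = (f $ 1) ^ q"
    by (subst startsby_zero_power_nth_same) auto
  finally show ?thesis .
qed

text \<open>The number \<open>N\<close> is at once the bound on the exponents and the precision;
  both will be \<open>p ^ e\<close>, because Frobenius makes \<open>f b ^ N\<close> constant exactly
  to that precision.\<close>

definition reduced_combinations ::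
    "nat \<Rightarrow> 'b::comm_ring_1 set \<Rightarrow> 'a set \<Rightarrow> ('a \<Rightarrow> 'b fps) \<Rightarrow> 'b fps set" where
  "reduced_combinations N S B f = {g. \<exists>F c. finite F \<and>
     F \<subseteq> {\<alpha>. Poly_Mapping.keys \<alpha> \<subseteq> B \<and> (\<forall>b. Poly_Mapping.lookup \<alpha> b < N)} \<and> c ` F \<subseteq> S \<and>
     cong_upto N g (\<Sum>\<alpha>\<in>F. fps_const (c \<alpha>) * mon f \<alpha>)}"

lemma reduced_combinations_cong:
  assumes g: "g \<in> reduced_combinations N S B f" and h: "cong_upto N h g"
  shows "h \<in> reduced_combinations N S B f"
proof -
  have "cong_upto N h g' \<longleftrightarrow> cong_upto N g g'" for g'
    using h by (simp add: cong_upto_def)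
  then show ?thesis using g by (simp add: reduced_combinations_def)
qed

lemma reduced_combinations_monomial:
  assumes "c \<in> S" "Poly_Mapping.keys \<alpha> \<subseteq> B" "\<And>b. Poly_Mapping.lookup \<alpha> b < N"
  shows "fps_const c * mon f \<alpha> \<in> reduced_combinations N S B f"
  unfolding reduced_combinations_def using assms
  by (intro CollectI exI[of _ "{\<alpha>}"] exI[of _ "\<lambda>_. c"]) auto

lemma reduced_combinations_diff:
  assumes S: "is_subring S"
    and g: "g \<in> reduced_combinations N S B f" and h: "h \<in> reduced_combinations N S B f"
  shows "g - h \<in> reduced_combinations N S B f"
proof -
  let ?P = "{\<alpha>. Poly_Mapping.keys \<alpha> \<subseteq> B \<and> (\<forall>b. Poly_Mapping.lookup \<alpha> b < N)}"
  obtain F c where F: "finite F" "F \<subseteq> ?P" "c ` F \<subseteq> S"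
      "cong_upto N g (\<Sum>\<alpha>\<in>F. fps_const (c \<alpha>) * mon f \<alpha>)"
    using g unfolding reduced_combinations_def by auto
  obtain G d where G: "finite G" "G \<subseteq> ?P" "d ` G \<subseteq> S"
      "cong_upto N h (\<Sum>\<alpha>\<in>G. fps_const (d \<alpha>) * mon f \<alpha>)"
    using h unfolding reduced_combinations_def by auto
  \<comment> \<open>Extending the coefficients by zero lets both sums run over
    \<open>F \<union> G\<close>.\<close>
  define c' where "c' \<alpha> = (if \<alpha> \<in> F then c \<alpha> else 0)" for \<alpha>
  define d' where "d' \<alpha> = (if \<alpha> \<in> G then d \<alpha> else 0)" for \<alpha>
  have "(\<Sum>\<alpha>\<in>F. fps_const (c \<alpha>) * mon f \<alpha>) = (\<Sum>\<alpha>\<in>F \<union> G. fps_const (c' \<alpha>) * mon f \<alpha>)"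
    using F(1) G(1) by (intro sum.mono_neutral_cong_left) (auto simp: c'_def)
  moreover have "(\<Sum>\<alpha>\<in>G. fps_const (d \<alpha>) * mon f \<alpha>) = (\<Sum>\<alpha>\<in>F \<union> G. fps_const (d' \<alpha>) * mon f \<alpha>)"
    using F(1) G(1) by (intro sum.mono_neutral_cong_left) (auto simp: d'_def)
  ultimately have "cong_upto N (g - h) (\<Sum>\<alpha>\<in>F \<union> G. fps_const (c' \<alpha> - d' \<alpha>) * mon f \<alpha>)"
    using cong_upto_diff[OF F(4) G(4)]
    by (simp add: fps_const_sub[symmetric] left_diff_distrib sum_subtractf del: fps_const_sub)
  moreover have "(\<lambda>\<alpha>. c' \<alpha> - d' \<alpha>) ` (F \<union> G) \<subseteq> S"
    using F(3) G(3)
    by (auto simp: c'_def d'_def image_subset_iff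
        intro: is_subring_diff[OF S] is_subring_uminus[OF S] is_subring_0[OF S])
  ultimately show ?thesis
    unfolding reduced_combinations_def using F(1,2) G(1,2)
    by (intro CollectI exI[of _ "F \<union> G"] exI[of _ "\<lambda>\<alpha>. c' \<alpha> - d' \<alpha>"]) auto
qed

lemma reduced_combinations_sum:
  assumes S: "is_subring S" and "\<And>i. i \<in> I \<Longrightarrow> g i \<in> reduced_combinations N S B f"
  shows "sum g I \<in> reduced_combinations N S B f"
proof -
  let ?L = "reduced_combinations N S B f"
  have 0: "0 \<in> ?L"
    unfolding reduced_combinations_def by (intro CollectI exI[of _ "{}"]) auto
  have "g + h \<in> ?L" if "g \<in> ?L" "h \<in> ?L" for g h
    using reduced_combinations_diff[OF S that(1) reduced_combinations_diff[OF S 0 that(2)]] by simp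
  then show ?thesis using assms(2)
    by (induction I rule: infinite_finite_induct) (auto intro: 0)
qed

lemma reduced_combinations_mult_const:
  assumes S: "is_subring S" and "a \<in> S" and g: "g \<in> reduced_combinations N S B f"
  shows "fps_const a * g \<in> reduced_combinations N S B f"
proof -
  let ?P = "{\<alpha>. Poly_Mapping.keys \<alpha> \<subseteq> B \<and> (\<forall>b. Poly_Mapping.lookup \<alpha> b < N)}"
  obtain F c where F: "finite F" "F \<subseteq> ?P" "c ` F \<subseteq> S"
      "cong_upto N g (\<Sum>\<alpha>\<in>F. fps_const (c \<alpha>) * mon f \<alpha>)"
    using g unfolding reduced_combinations_def by auto
  have "cong_upto N (fps_const a * g) (\<Sum>\<alpha>\<in>F. fps_const (a * c \<alpha>) * mon f \<alpha>)"
    using cong_upto_mult[OF cong_upto_refl[of N "fps_const a"] F(4)]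
    by (simp add: sum_distrib_left mult.assoc fps_const_mult[symmetric] del: fps_const_mult)
  then show ?thesis
    unfolding reduced_combinations_def using F(1-3) \<open>a \<in> S\<close>
    by (intro CollectI exI[of _ F] exI[of _ "\<lambda>\<alpha>. a * c \<alpha>"]) (auto intro!: is_subring_mult[OF S])
qed

text \<open>Multiplication by \<open>f b\<close> raises one exponent. If that exponent reaches
  \<open>N\<close>, the factor \<open>f b ^ N\<close> is a constant from \<open>S\<close> modulo
  \<open>t^N\<close> and is absorbed into the coefficient.\<close>

lemma reduced_combinations_mult_generator:
  assumes S: "is_subring S" and "b \<in> B" "s \<in> S" and pow: "cong_upto N (f b ^ N) (fps_const s)"
    and g: "g \<in> reduced_combinations N S B f"
  shows "g * f b \<in> reduced_combinations N S B f"
proof -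
  let ?P = "{\<alpha>. Poly_Mapping.keys \<alpha> \<subseteq> B \<and> (\<forall>b. Poly_Mapping.lookup \<alpha> b < N)}"
  let ?L = "reduced_combinations N S B f"
  obtain F c where F: "finite F" "F \<subseteq> ?P" "c ` F \<subseteq> S"
      "cong_upto N g (\<Sum>\<alpha>\<in>F. fps_const (c \<alpha>) * mon f \<alpha>)"
    using g unfolding reduced_combinations_def by auto
  have *: "fps_const (c \<alpha>) * mon f \<alpha> * f b \<in> ?L" if "\<alpha> \<in> F" for \<alpha>
  proof (cases "Suc (Poly_Mapping.lookup \<alpha> b) < N")
    case True
    have "Poly_Mapping.keys (\<alpha> + Poly_Mapping.single b 1) \<subseteq> B"
      using Poly_Mapping.keys_add[of \<alpha> "Poly_Mapping.single b 1"] F(2) that \<open>b \<in> B\<close> by auto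
    moreover have "Poly_Mapping.lookup (\<alpha> + Poly_Mapping.single b 1) b' < N" for b'
      using True F(2) that by (auto simp: lookup_add lookup_single when_def)
    ultimately show ?thesis
      using reduced_combinations_monomial[of "c \<alpha>" S "\<alpha> + Poly_Mapping.single b 1" B N f] F(3) that
      by (auto simp: mon_add mult.assoc)
  next
    case False
    \<comment> \<open>Here \<open>b\<close> has exponent \<open>N - 1\<close> in \<alpha>; \<beta>
      is the part of \<alpha> without \<open>b\<close>.\<close>
    define \<beta> where "\<beta> = Poly_Mapping.update b 0 \<alpha>"
    have \<beta>: "Poly_Mapping.keys \<beta> \<subseteq> B" "Poly_Mapping.lookup \<beta> b' < N" for b'
      using F(2) that False by (fastforce simp: \<beta>_def keys_update lookup_update)+
    have "Poly_Mapping.lookup \<alpha> b < N" using F(2) that by auto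
    then have "Suc (Poly_Mapping.lookup \<alpha> b) = N" using False by simp
    moreover have "\<alpha> = \<beta> + Poly_Mapping.single b (Poly_Mapping.lookup \<alpha> b)"
      by (rule poly_mapping_eqI) (auto simp: \<beta>_def lookup_add lookup_update lookup_single when_def)
    ultimately have "mon f \<alpha> * f b = mon f \<beta> * f b ^ N"
      by (metis mon_add mon_single mult.assoc power_Suc2)
    then have "fps_const (c \<alpha>) * mon f \<alpha> * f b = fps_const (c \<alpha>) * mon f \<beta> * f b ^ N"
      by (simp add: mult.assoc)
    then have "cong_upto N (fps_const (c \<alpha>) * mon f \<alpha> * f b) (fps_const (s * c \<alpha>) * mon f \<beta>)"
      using cong_upto_mult[OF cong_upto_refl[of N "fps_const (c \<alpha>) * mon f \<beta>"] pow]
      by (simp add: mult_ac fps_const_mult[symmetric] del: fps_const_mult)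
    moreover have "fps_const (s * c \<alpha>) * mon f \<beta> \<in> ?L"
      using \<beta> F(3) that \<open>s \<in> S\<close> by (intro reduced_combinations_monomial) (auto intro: is_subring_mult[OF S])
    ultimately show ?thesis by (rule reduced_combinations_cong[rotated])
  qed
  have "cong_upto N (g * f b) (\<Sum>\<alpha>\<in>F. fps_const (c \<alpha>) * mon f \<alpha> * f b)"
    using cong_upto_mult[OF F(4) cong_upto_refl] by (simp add: sum_distrib_right)
  moreover have "(\<Sum>\<alpha>\<in>F. fps_const (c \<alpha>) * mon f \<alpha> * f b) \<in> ?L"
    using * by (rule reduced_combinations_sum[OF S])
  ultimately show ?thesis by (rule reduced_combinations_cong[rotated])
qed

text \<open>The multipliers that preserve the set of reduced combinations form a subring containing
  all generators; applying them to 1 gives the inclusion. No product of two general combinations has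
  to be expanded.\<close>

lemma hull_subset_reduced_combinations:
  assumes S: "is_subring S" and "N > 0"
    and pow: "\<And>b. b \<in> B \<Longrightarrow> \<exists>s\<in>S. cong_upto N (f b ^ N) (fps_const s)"
  shows "is_subring hull (fps_const ` S \<union> f ` B) \<subseteq> reduced_combinations N S B f"
proof -
  let ?L = "reduced_combinations N S B f"
  have "is_subring {a. \<forall>h\<in>?L. h * a \<in> ?L}"
    unfolding is_subring_def
    by (auto simp: right_diff_distrib mult.assoc[symmetric] intro: reduced_combinations_diff[OF S])
  moreover have "h * fps_const s \<in> ?L" if "s \<in> S" "h \<in> ?L" for s h
    using reduced_combinations_mult_const[OF S that] by (simp add: mult.commute)
  moreover have "h * f b \<in> ?L" if "b \<in> B" "h \<in> ?L" for b h
    using pow[OF that(1)] reduced_combinations_mult_generator[OF S that(1) _ _ that(2)] by auto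
  ultimately have "is_subring hull (fps_const ` S \<union> f ` B) \<subseteq> {a. \<forall>h\<in>?L. h * a \<in> ?L}"
    by (intro hull_minimal) auto
  moreover have "1 \<in> ?L"
    using reduced_combinations_monomial[of 1 S 0 B N f] is_subring_1[OF S] \<open>N > 0\<close> by simp
  ultimately show ?thesis by force
qed

subsection \<open>Hasse-Schmidt derivations as ring homomorphisms\<close>

text \<open>A Hasse-Schmidt derivation of length \<open>n\<close> is encoded by \<open>x \<mapsto> \<Sum>i. D i x * t^i\<close>, a ring homomorphism
  modulo \<open>t^M\<close> with \<open>M = n + 1\<close>; the coefficients from \<open>t^M\<close> on are arbitrary.\<close>

definition hs_hom :: "'a::comm_ring_1 set \<Rightarrow> nat \<Rightarrow> ('a \<Rightarrow> 'a fps) \<Rightarrow> bool" where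
  "hs_hom K M \<phi> \<longleftrightarrow> (\<forall>x. \<phi> x $ 0 = x) \<and> (\<forall>c\<in>K. cong_upto M (\<phi> c) (fps_const c)) \<and>
     (\<forall>x y. cong_upto M (\<phi> (x + y)) (\<phi> x + \<phi> y) \<and> cong_upto M (\<phi> (x * y)) (\<phi> x * \<phi> y))"

lemma
  assumes "hs_hom K M \<phi>"
  shows hs_hom_nth_0: "\<phi> x $ 0 = x"
    and hs_hom_const: "c \<in> K \<Longrightarrow> cong_upto M (\<phi> c) (fps_const c)"
    and hs_hom_add: "cong_upto M (\<phi> (x + y)) (\<phi> x + \<phi> y)"
    and hs_hom_mult: "cong_upto M (\<phi> (x * y)) (\<phi> x * \<phi> y)"
    and hs_hom_0: "cong_upto M (\<phi> 0) 0"
    and hs_hom_diff: "cong_upto M (\<phi> (x - y)) (\<phi> x - \<phi> y)"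
proof -
  show "\<phi> x $ 0 = x" "c \<in> K \<Longrightarrow> cong_upto M (\<phi> c) (fps_const c)"
    and add: "cong_upto M (\<phi> (x + y)) (\<phi> x + \<phi> y)" "cong_upto M (\<phi> (x * y)) (\<phi> x * \<phi> y)" for x y c
    using assms by (auto simp: hs_hom_def)
  show "cong_upto M (\<phi> 0) 0" using cong_upto_diff[OF add(1)[of 0 0] cong_upto_refl[of M "\<phi> 0"]]
    by (simp add: cong_upto_sym)
  show "cong_upto M (\<phi> (x - y)) (\<phi> x - \<phi> y)"
    using add(1)[of "x - y" y] by (simp add: cong_upto_def)
qed

lemma hs_hom_antimono: "hs_hom K M \<phi> \<Longrightarrow> M' \<le> M \<Longrightarrow> hs_hom K M' \<phi>"
  unfolding hs_hom_def using cong_upto_antimono by blast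

lemma hs_hom_sum:
  assumes "hs_hom K M \<phi>"
  shows "cong_upto M (\<phi> (sum h I)) (\<Sum>i\<in>I. \<phi> (h i))"
proof (induction I rule: infinite_finite_induct)
  case (insert i I)
  then show ?case
    using hs_hom_add[OF assms, of "h i" "sum h I"] by (simp add: cong_upto_def)
qed (use hs_hom_0[OF assms] in auto)

lemma hs_hom_1:
  assumes "hs_hom K M \<phi>" "is_subring K"
  shows "cong_upto M (\<phi> 1) 1"
  using hs_hom_const[OF assms(1) is_subring_1[OF assms(2)]] by simp

lemma hs_hom_power:
  assumes "hs_hom K M \<phi>" "is_subring K"
  shows "cong_upto M (\<phi> (x ^ n)) (\<phi> x ^ n)"
proof (induction n)
  case 0
  then show ?case using hs_hom_1[OF assms] by simp
next
  case (Suc n)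
  show ?case
    using cong_upto_trans[OF hs_hom_mult[OF assms(1)] cong_upto_mult[OF cong_upto_refl Suc]] by simp
qed

lemma is_subring_hs_hom_equalizer:
  assumes "hs_hom K M \<phi>" "hs_hom K M \<psi>" "is_subring K"
  shows "is_subring {x. cong_upto M (\<phi> x) (\<psi> x)}"
  unfolding is_subring_def
proof (intro conjI ballI CollectI; clarsimp?)
  show "cong_upto M (\<phi> 1) (\<psi> 1)"
    by (rule cong_upto_trans[OF hs_hom_1[OF assms(1,3)] cong_upto_sym[OF hs_hom_1[OF assms(2,3)]]])
  fix x y assume *: "cong_upto M (\<phi> x) (\<psi> x)" "cong_upto M (\<phi> y) (\<psi> y)"
  show "cong_upto M (\<phi> (x - y)) (\<psi> (x - y))"
    using cong_upto_trans[OF cong_upto_trans[OF hs_hom_diff[OF assms(1)] cong_upto_diff[OF *]]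
        cong_upto_sym[OF hs_hom_diff[OF assms(2)]]] .
  show "cong_upto M (\<phi> (x * y)) (\<psi> (x * y))"
    using cong_upto_trans[OF cong_upto_trans[OF hs_hom_mult[OF assms(1)] cong_upto_mult[OF *]]
        cong_upto_sym[OF hs_hom_mult[OF assms(2)]]] .
qed

section \<open>Homomorphisms modulo \<open>t^M\<close>: uniqueness and prescription on
  generators\<close>

lemma hs_hom_fps_const: "hs_hom K M fps_const"
  by (simp add: hs_hom_def)

lemma hs_hom_pow_subring:
  fixes K :: "'a::comm_ring_1 set"
  assumes "prime p" "CHAR('a) = p" "hs_hom K M \<phi>" "is_subring K" "M \<le> p ^ e"
    and "c \<in> pow_subring p e K"
  shows "cong_upto M (\<phi> c) (fps_const c)"
proof -
  have "cong_upto (p ^ e) (\<phi> r ^ (p ^ e)) (fps_const (r ^ (p ^ e)))" for r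
    using cong_upto_frobenius[OF _ hs_hom_nth_0[OF assms(3)], where e = e] assms(1,2) by simp
  then have "cong_upto M (\<phi> (r ^ (p ^ e))) (fps_const (r ^ (p ^ e)))" for r
    by (rule cong_upto_trans[OF hs_hom_power[OF assms(3,4)] cong_upto_antimono[OF _ assms(5)]])
  then have "pow_subring p e K \<subseteq> {x. cong_upto M (\<phi> x) (fps_const x)}"
    unfolding pow_subring_def
    using is_subring_hs_hom_equalizer[OF assms(3) hs_hom_fps_const assms(4)] hs_hom_const[OF assms(3)]
    by (intro hull_minimal) auto
  then show ?thesis using assms(6) by auto
qed

text \<open>Both maps agree with the constant embedding on \<open>pow_subring p e K\<close>, and
  their equalizer is a subring, so agreement on \<open>B\<close> spreads to everything
  generated.\<close>

lemma hs_hom_unique: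
  fixes K :: "'a::comm_ring_1 set"
  assumes "prime p" "CHAR('a) = p" "is_subring K" "hs_hom K M \<phi>" "hs_hom K M \<psi>" "M \<le> p ^ e"
    and gen: "is_subring hull (pow_subring p e K \<union> B) = UNIV"
    and B: "\<And>b. b \<in> B \<Longrightarrow> cong_upto M (\<phi> b) (\<psi> b)"
  shows "cong_upto M (\<phi> x) (\<psi> x)"
proof -
  have "cong_upto M (\<phi> c) (\<psi> c)" if "c \<in> pow_subring p e K" for c
    using cong_upto_trans[OF hs_hom_pow_subring[OF assms(1,2,4,3,6) that]
        cong_upto_sym[OF hs_hom_pow_subring[OF assms(1,2,5,3,6) that]]] .
  then have "is_subring hull (pow_subring p e K \<union> B) \<subseteq> {x. cong_upto M (\<phi> x) (\<psi> x)}"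
    using B is_subring_hs_hom_equalizer[OF assms(4,5,3)] by (intro hull_minimal) auto
  then show ?thesis using gen by auto
qed

text \<open>Let \<open>A\<close> be the ring of series generated by the constants from
  \<open>pow_subring p e K\<close> and the \<open>f b\<close>. Taking constant terms maps
  \<open>A\<close> onto \<open>R\<close> because \<open>B\<close> generates, and is injective modulo
  \<open>t^(p^e)\<close> because \<open>B\<close> is independent. Any section is the required
  map.\<close>

lemma p_basis_lift:
  fixes K :: "'a::comm_ring_1 set"
  assumes "prime p" "CHAR('a) = p" "p_basis p e K B"
    and f: "\<And>b. b \<in> B \<Longrightarrow> f b $ 0 = b"
  shows "\<exists>\<Phi>. hs_hom K (p ^ e) \<Phi> \<and> (\<forall>b\<in>B. cong_upto (p ^ e) (\<Phi> b) (f b))"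
proof -
  let ?N = "p ^ e" and ?S = "pow_subring p e K"
  define A where "A = is_subring hull (fps_const ` ?S \<union> f ` B)"
  have A: "is_subring A" by (simp add: A_def)
  have const_A: "fps_const c \<in> A" if "c \<in> ?S" for c using that by (auto simp: A_def intro: hull_inc)
  have f_A: "f b \<in> A" if "b \<in> B" for b using that by (auto simp: A_def intro: hull_inc)
  have N: "?N > 0" using \<open>prime p\<close> by (simp add: prime_gt_0_nat)
  have ind: "p_independent p e K B" and gen: "is_subring hull (?S \<union> B) = UNIV"
    using assms(3) by (auto simp: p_basis_def)
  have "\<exists>s\<in>?S. cong_upto ?N (f b ^ ?N) (fps_const s)" if "b \<in> B" for b
    using cong_upto_frobenius[of "f b" b e] f[OF that] assms(1,2) power_in_pow_subring[of b p e K] by auto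
  then have nf: "A \<subseteq> reduced_combinations ?N ?S B f"
    unfolding A_def using N by (intro hull_subset_reduced_combinations) auto
  \<comment> \<open>Injectivity: the constant term of a reduced combination of the
    \<open>f b\<close> is the same combination of reduced monomials in \<open>B\<close>, so its
    vanishing kills all coefficients.\<close>
  have zero: "cong_upto ?N g 0" if "g \<in> A" "g $ 0 = 0" for g
  proof -
    have "g \<in> reduced_combinations ?N ?S B f" using nf that(1) by blast
    then obtain F c where F: "finite F" "F \<subseteq> reduced_exponents p e B" "c ` F \<subseteq> ?S"
      "cong_upto ?N g (\<Sum>\<alpha>\<in>F. fps_const (c \<alpha>) * mon f \<alpha>)"
      unfolding reduced_combinations_def reduced_exponents_def by auto
    have "mon f \<alpha> $ 0 = monomial_value \<alpha>" if "\<alpha> \<in> F" for \<alpha>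
      unfolding mon_nth_0 monomial_value_eq_mon
      using F(2) that f by (intro mon_cong) (auto simp: reduced_exponents_def)
    then have "(\<Sum>\<alpha>\<in>F. c \<alpha> * monomial_value \<alpha>) = (\<Sum>\<alpha>\<in>F. fps_const (c \<alpha>) * mon f \<alpha>) $ 0"
      by (simp add: fps_sum_nth)
    also have "\<dots> = 0" using F(4) N that(2) by (simp add: cong_upto_def)
    finally have "\<forall>\<alpha>\<in>F. c \<alpha> = 0"
      using ind F(1-3) unfolding p_independent_def by blast
    then show ?thesis using F(4) by simp
  qed
  have cong: "cong_upto ?N g h" if "g \<in> A" "h \<in> A" "g $ 0 = h $ 0" for g h
    using zero[OF is_subring_diff[OF A that(1,2)]] that(3) by (simp add: cong_upto_def)
  \<comment> \<open>Surjectivity: the constant terms form a subring containing all generators of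
    \<open>R\<close>.\<close>
  have "is_subring ((\<lambda>g. g $ 0) ` A)"
    unfolding is_subring_def
    using is_subring_1[OF A]
    by (auto simp flip: fps_sub_nth fps_mult_nth_0
        intro!: imageI is_subring_diff[OF A] is_subring_mult[OF A] intro: image_eqI[of _ _ 1])
  moreover have "c \<in> (\<lambda>g. g $ 0) ` A" if "c \<in> ?S" for c
    using const_A[OF that] by (intro image_eqI[of _ _ "fps_const c"]) auto
  moreover have "b \<in> (\<lambda>g. g $ 0) ` A" if "b \<in> B" for b
    using f_A[OF that] f[OF that] by (intro image_eqI[of _ _ "f b"]) auto
  ultimately have "is_subring hull (?S \<union> B) \<subseteq> (\<lambda>g. g $ 0) ` A"
    by (intro hull_minimal) auto
  then have "\<forall>x. \<exists>g. g \<in> A \<and> g $ 0 = x" using gen by (metis UNIV_I imageE subsetD)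
  then obtain \<Phi> where \<Phi>: "\<Phi> x \<in> A" "\<Phi> x $ 0 = x" for x by metis
  \<comment> \<open>In each law both sides lie in \<open>A\<close> and have the same constant term,
    so injectivity applies.\<close>
  have "hs_hom K ?N \<Phi>"
    unfolding hs_hom_def
  proof (intro conjI allI ballI)
    fix c assume "c \<in> K"
    then have "c \<in> ?S" using subset_pow_subring by blast
    then show "cong_upto ?N (\<Phi> c) (fps_const c)"
      using const_A by (intro cong) (auto simp: \<Phi>)
  qed (auto simp: \<Phi> intro!: cong is_subring_add[OF A] is_subring_mult[OF A])
  moreover have "cong_upto ?N (\<Phi> b) (f b)" if "b \<in> B" for b
    using f_A[OF that] f[OF that] by (intro cong) (auto simp: \<Phi>)
  ultimately show ?thesis by blast
qed

section \<open>Passage between Hasse-Schmidt sequences and homomorphisms\<close>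

lemma HS_one_eq_0:
  assumes "D \<in> HS K (enat n)" "0 < i" "i \<le> n"
  shows "D i 1 = 0"
  using assms(2,3)
proof (induction i rule: less_induct)
  case (less i)
  have "D i (1 * 1) = (\<Sum>j\<le>i. D j 1 * D (i - j) 1)"
    using assms(1) less.prems(2) unfolding HS_def by (simp del: mult_1 mult_1_right)
  \<comment> \<open>By induction only the two end terms survive, which leaves
    \<open>D i 1 = D i 1 + D i 1\<close>.\<close>
  also have "\<dots> = (\<Sum>j\<in>{0, i}. D j 1 * D (i - j) 1)"
    using less by (intro sum.mono_neutral_right) auto
  also have "\<dots> = D i 1 + D i 1"
    using assms(1) less.prems by (auto simp: HS_def)
  finally show ?case by simp
qed

lemma hs_hom_of_HS:
  assumes "D \<in> HS K (enat n)" "M \<le> Suc n"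
  shows "hs_hom K M (\<lambda>x. Abs_fps (\<lambda>i. D i x))"
  unfolding hs_hom_def
proof (intro conjI allI ballI)
  show "Abs_fps (\<lambda>i. D i x) $ 0 = x" for x using assms by (simp add: HS_def)
  have D: "linear_over K (D i)" "D i (x * y) = (\<Sum>j\<le>i. D j x * D (i - j) y)" if "i < M" for i x y
    using assms that by (auto simp: HS_def)
  show "cong_upto M (Abs_fps (\<lambda>i. D i c)) (fps_const c)" if "c \<in> K" for c
    unfolding cong_upto_def
  proof (intro allI impI)
    fix i assume "i < M"
    \<comment> \<open>Linearity over \<open>K\<close> becomes the condition that elements of
      \<open>K\<close> have constant series, since \<open>D i 1\<close> vanishes for positive
      \<open>i\<close>.\<close>
    have "D i (c * 1) = c * D i 1" using D(1)[OF \<open>i < M\<close>] that unfolding linear_over_def by blast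
    then show "Abs_fps (\<lambda>i. D i c) $ i = fps_const c $ i"
      using HS_one_eq_0[OF assms(1), of i] assms \<open>i < M\<close> by (cases "i = 0") (auto simp: HS_def)
  qed
  show "cong_upto M (Abs_fps (\<lambda>i. D i (x + y))) (Abs_fps (\<lambda>i. D i x) + Abs_fps (\<lambda>i. D i y))" for x y
    using D(1) by (auto simp: cong_upto_def linear_over_def)
  show "cong_upto M (Abs_fps (\<lambda>i. D i (x * y))) (Abs_fps (\<lambda>i. D i x) * Abs_fps (\<lambda>i. D i y))" for x y
    using D(2) by (auto simp: cong_upto_def fps_mult_nth atLeast0AtMost)
qed

lemma HS_of_hs_hom:
  assumes "hs_hom K (Suc n) \<phi>"
  shows "restrict (\<lambda>i x. \<phi> x $ i) {i. enat i \<le> enat n} \<in> HS K (enat n)"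
proof -
  have nth: "\<phi> (x + y) $ i = \<phi> x $ i + \<phi> y $ i" "\<phi> (x * y) $ i = (\<Sum>j\<le>i. \<phi> x $ j * \<phi> y $ (i - j))"
    if "i \<le> n" for i x y
    using hs_hom_add[OF assms, of x y] hs_hom_mult[OF assms, of x y] that
    by (auto simp: cong_upto_def fps_mult_nth atLeast0AtMost)
  have "\<phi> (c * x) $ i = c * \<phi> x $ i" if "c \<in> K" "i \<le> n" for c x i
  proof -
    have "cong_upto (Suc n) (\<phi> (c * x)) (fps_const c * \<phi> x)"
      by (rule cong_upto_trans[OF hs_hom_mult[OF assms]
            cong_upto_mult[OF hs_hom_const[OF assms that(1)] cong_upto_refl]])
    then show ?thesis using that by (simp add: cong_upto_def)
  qed
  then show ?thesis
    using nth hs_hom_nth_0[OF assms]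
    by (auto simp: HS_def linear_over_def fun_eq_iff simp del: fps_mult_nth_0 intro!: sum.cong)
qed

lemma Der_of_hs_hom:
  assumes "hs_hom K M \<phi>" "M \<ge> 2"
  shows "(\<lambda>x. \<phi> x $ 1) \<in> Der K"
proof -
  have "restrict (\<lambda>i x. \<phi> x $ i) {i. enat i \<le> enat 1} \<in> HS K (enat 1)"
    using assms by (intro HS_of_hs_hom) (auto intro: hs_hom_antimono)
  then show ?thesis
    using hs_hom_nth_0[OF assms(1)] by (fastforce simp: HS_def Der_def)
qed

text \<open>For \<open>b\<close> in \<open>B\<close> this is the partial derivative along
  \<open>b\<close>: the coefficient of \<open>t\<close> in a lift that sends \<open>b\<close> to
  \<open>b + t\<close> and fixes the rest of \<open>B\<close>. The precision
  \<open>p \<ge> 2\<close> keeps that coefficient.\<close>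

lemma p_basis_derivation:
  fixes K :: "'a::comm_ring_1 set"
  assumes "prime p" "CHAR('a) = p" "p_basis p 1 K B"
  shows "\<exists>\<delta>\<in>Der K. \<forall>b'\<in>B. \<delta> b' = (if b' = b then 1 else 0)"
proof -
  have p: "p ^ 1 \<ge> 2" using \<open>prime p\<close> by (simp add: prime_ge_2_nat)
  define f where "f b' = fps_const b' + (if b' = b then fps_X else 0)" for b' :: 'a
  have "f b' $ 0 = b'" "f b' $ 1 = (if b' = b then 1 else 0)" for b'
    by (auto simp: f_def)
  moreover from this obtain \<Phi> where "hs_hom K (p ^ 1) \<Phi>" "\<forall>b'\<in>B. cong_upto (p ^ 1) (\<Phi> b') (f b')"
    using p_basis_lift[OF assms, of f] by blast
  ultimately show ?thesis
    using p by (intro bexI[of _ "\<lambda>x. \<Phi> x $ 1"] Der_of_hs_hom) (auto simp: cong_upto_def)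
qed

text \<open>The series of \<open>D\<close> on \<open>B\<close> are prescribed to the larger
  precision \<open>p ^ e\<close>. The lift agrees with \<open>D\<close> on \<open>B\<close> modulo
  \<open>t^(m+1)\<close>, hence everywhere by uniqueness.\<close>

lemma p_basis_integrable:
  fixes K :: "'a::comm_ring_1 set"
  assumes "prime p" "CHAR('a) = p" "is_subring K" "p_basis p e K B" "m \<le> p ^ e - 1"
  shows "HS K (enat m) = IHS K (enat m) (enat (p ^ e - 1))"
proof -
  have N: "p ^ e > 0" using \<open>prime p\<close> by (simp add: prime_gt_0_nat)
  have "\<exists>E\<in>HS K (enat (p ^ e - 1)). truncation (enat m) E = D" if D: "D \<in> HS K (enat m)" for D
  proof -
    \<comment> \<open>Beyond index \<open>m\<close> the coefficients are unspecified values; any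
      choice on \<open>B\<close> yields an integral.\<close>
    define \<phi> where "\<phi> x = Abs_fps (\<lambda>i. D i x)" for x
    have \<phi>: "hs_hom K (Suc m) \<phi>"
      unfolding \<phi>_def using hs_hom_of_HS[OF D] by simp
    obtain \<Phi> where \<Phi>: "hs_hom K (p ^ e) \<Phi>" "\<And>b. b \<in> B \<Longrightarrow> cong_upto (p ^ e) (\<Phi> b) (\<phi> b)"
      using p_basis_lift[OF assms(1,2,4), of \<phi>] hs_hom_nth_0[OF \<phi>] by auto
    have m: "Suc m \<le> p ^ e" using N assms(5) by linarith
    have "cong_upto (Suc m) (\<Phi> x) (\<phi> x)" for x
      using hs_hom_unique[OF assms(1-3) hs_hom_antimono[OF \<Phi>(1) m] \<phi> m, of B]
        assms(4) cong_upto_antimono[OF \<Phi>(2) m] by (auto simp: p_basis_def)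
    then have eq: "\<Phi> x $ i = D i x" if "i \<le> m" for i x
      using that by (simp add: cong_upto_def \<phi>_def)
    let ?E = "restrict (\<lambda>i x. \<Phi> x $ i) {i. enat i \<le> enat (p ^ e - 1)}"
    have "D i = truncation (enat m) ?E i" for i
      using eq D assms(5) by (auto simp: truncation_def HS_def extensional_def fun_eq_iff)
    moreover have "?E \<in> HS K (enat (p ^ e - 1))"
      using \<Phi>(1) N by (intro HS_of_hs_hom) simp
    ultimately show ?thesis by (metis ext)
  qed
  then show ?thesis by (auto simp: IHS_def)
qed

subsection \<open>From integrable derivations to \<open>p\<^sup>s\<close>-bases\<close>

lemma Der_power:
  assumes "\<delta> \<in> Der K"
  shows "\<delta> (x ^ Suc n) = of_nat (Suc n) * x ^ n * \<delta> x"
proof (induction n)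
  case (Suc n)
  have "\<delta> (x ^ Suc (Suc n)) = x * \<delta> (x ^ Suc n) + \<delta> x * x ^ Suc n"
    using assms unfolding Der_def by (subst power_Suc) blast
  then show ?case unfolding Suc by (simp add: algebra_simps)
qed simp

lemma Der_1:
  assumes "\<delta> \<in> Der K"
  shows "\<delta> 1 = 0"
proof -
  have "\<delta> (1 * 1) = 1 * \<delta> 1 + \<delta> 1 * 1" using assms unfolding Der_def by blast
  then show ?thesis by simp
qed

lemma Der_eq_0_power: "\<delta> \<in> Der K \<Longrightarrow> \<delta> x = 0 \<Longrightarrow> \<delta> (x ^ n) = 0"
  by (cases n) (auto simp: Der_1 Der_power simp del: power_Suc)

lemma Der_mon_eq_0:
  assumes "\<delta> \<in> Der K" "\<And>b. b \<in> Poly_Mapping.keys \<alpha> \<Longrightarrow> \<delta> (f b) = 0"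
  shows "\<delta> (mon f \<alpha>) = 0"
proof -
  have "\<delta> (\<Prod>b\<in>S. f b ^ Poly_Mapping.lookup \<alpha> b) = 0" if "S \<subseteq> Poly_Mapping.keys \<alpha>" for S
    using that
  proof (induction S rule: infinite_finite_induct)
    case (insert b S)
    then show ?case
      using assms Der_eq_0_power[OF assms(1) assms(2)[of b]] by (auto simp: Der_def)
  qed (auto simp: Der_1[OF assms(1)])
  then show ?thesis by (simp add: mon_def)
qed

text \<open>Away from \<open>b\<close> the monomial is killed by \<delta>, so only the power rule
  for \<open>b\<close> contributes. Starting from \<beta> with one more \<open>b\<close> avoids
  subtracting exponents.\<close>

lemma Der_mon_add_single:
  assumes "\<delta> \<in> Der K" "\<delta> b = 1" "\<And>b'. b' \<in> Poly_Mapping.keys \<beta> \<Longrightarrow> b' \<noteq> b \<Longrightarrow> \<delta> b' = 0"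
  shows "\<delta> (mon (\<lambda>b. b) (\<beta> + Poly_Mapping.single b 1))
    = of_nat (Suc (Poly_Mapping.lookup \<beta> b)) * mon (\<lambda>b. b) \<beta>"
proof -
  define n where "n = Poly_Mapping.lookup \<beta> b"
  define \<beta>0 where "\<beta>0 = Poly_Mapping.update b 0 \<beta>"
  have \<beta>: "\<beta> = \<beta>0 + Poly_Mapping.single b n"
    by (rule poly_mapping_eqI) (auto simp: \<beta>0_def n_def lookup_add lookup_update lookup_single when_def)
  have 0: "\<delta> (mon (\<lambda>b. b) \<beta>0) = 0"
    by (rule Der_mon_eq_0[OF assms(1)]) (auto simp: \<beta>0_def keys_update intro: assms(3))
  have "mon (\<lambda>b. b) (\<beta> + Poly_Mapping.single b 1) = mon (\<lambda>b. b) \<beta>0 * b ^ Suc n"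
    by (simp add: \<beta> mon_add mult_ac)
  then have "\<delta> (mon (\<lambda>b. b) (\<beta> + Poly_Mapping.single b 1))
      = mon (\<lambda>b. b) \<beta>0 * \<delta> (b ^ Suc n) + \<delta> (mon (\<lambda>b. b) \<beta>0) * b ^ Suc n"
    using assms(1) by (simp add: Der_def del: power_Suc)
  then show ?thesis
    by (simp add: 0 Der_power[OF assms(1)] assms(2) n_def[symmetric] del: power_Suc)
      (simp add: \<beta> mon_add mult_ac)
qed

text \<open>Bezout gives \<open>k * x = p * y + 1\<close>. This allows exponents produced by
  differentiation to be cancelled although \<open>R\<close> need not be a domain.\<close>

lemma of_nat_unit_CHAR:
  assumes "prime p" "CHAR('a::comm_ring_1) = p" "0 < k" "k < p"
  shows "\<exists>u::'a. of_nat k * u = 1"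
proof -
  have "coprime p k"
    using assms(1,3,4) by (intro prime_imp_coprime) (auto simp: nat_dvd_not_less)
  then have "gcd k p = 1" by (metis coprime_imp_gcd_eq_1 gcd.commute)
  then obtain x y where "k * x = p * y + 1"
    using bezout_nat[of k p] assms(3) by auto
  then have "(of_nat k * of_nat x :: 'a) = of_nat p * of_nat y + 1"
    by (metis of_nat_1 of_nat_add of_nat_mult)
  then show ?thesis using assms(2) of_nat_CHAR[where ?'a = 'a] by auto
qed

text \<open>Apply the homomorphism of \<open>E\<close> to the relation modulo
  \<open>t^(q+1)\<close>, where the \<open>c i\<close> are still constant, and compare coefficients
  of \<open>t^q\<close>; \<open>frobenius_nth\<close> identifies them.\<close>

lemma HS_frobenius_relation:
  fixes K :: "'a::comm_ring_1 set"
  assumes "prime p" "CHAR('a) = p" "is_subring K" "E \<in> HS K (enat n)" and q: "q = p ^ s" and "q \<le> n"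
    and c: "\<And>i. i \<in> I \<Longrightarrow> c i \<in> pow_subring p (Suc s) K"
    and rel: "(\<Sum>i\<in>I. c i * r i ^ q) = 0"
  shows "(\<Sum>i\<in>I. c i * E 1 (r i) ^ q) = 0"
proof -
  define \<phi> where "\<phi> x = Abs_fps (\<lambda>i. E i x)" for x
  have \<phi>: "hs_hom K (Suc q) \<phi>"
    unfolding \<phi>_def using assms(4,6) by (intro hs_hom_of_HS) auto
  have p: "p \<ge> 2" using assms(1) by (rule prime_ge_2_nat)
  then have "q > 0" by (simp add: q)
  \<comment> \<open>Precision \<open>q + 1\<close> reaches the coefficient of \<open>t^q\<close> and
    still lies within the bound \<open>p ^ Suc s\<close> up to which elements of
    \<open>pow_subring p (Suc s) K\<close> are constant.\<close>
  then have "2 * q \<le> p * q" "Suc q \<le> 2 * q" using p by auto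
  then have "Suc q \<le> p * q" by (rule le_trans[rotated])
  then have le: "Suc q \<le> p ^ Suc s" by (simp add: q)
  have "cong_upto (Suc q) (\<phi> (c i * r i ^ q)) (fps_const (c i) * \<phi> (r i) ^ q)" if "i \<in> I" for i
    by (rule cong_upto_trans[OF hs_hom_mult[OF \<phi>]])
      (intro cong_upto_mult hs_hom_power[OF \<phi> assms(3)]
        hs_hom_pow_subring[OF assms(1,2) \<phi> assms(3) le c[OF that]])
  then have "cong_upto (Suc q) (\<Sum>i\<in>I. \<phi> (c i * r i ^ q)) (\<Sum>i\<in>I. fps_const (c i) * \<phi> (r i) ^ q)"
    by (rule cong_upto_sum)
  then have "cong_upto (Suc q) (\<phi> 0) (\<Sum>i\<in>I. fps_const (c i) * \<phi> (r i) ^ q)"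
    using cong_upto_trans[OF hs_hom_sum[OF \<phi>, of "\<lambda>i. c i * r i ^ q" I]] rel by simp
  then have "cong_upto (Suc q) 0 (\<Sum>i\<in>I. fps_const (c i) * \<phi> (r i) ^ q)"
    by (rule cong_upto_trans[OF cong_upto_sym[OF hs_hom_0[OF \<phi>]]])
  then have "0 = (\<Sum>i\<in>I. c i * (\<phi> (r i) ^ q) $ q)"
    by (simp add: cong_upto_def fps_sum_nth)
  moreover have "(\<phi> x ^ q) $ q = E 1 x ^ q" for x
    using frobenius_nth[of q s "\<phi> x"] assms(1,2) by (simp add: q \<phi>_def)
  ultimately show ?thesis by simp
qed

text \<open>Applying the derivation dual to \<open>b\<close> lowers the degree in \<open>b\<close>, so all coefficients vanish by induction
  on the degree; \<open>mon (\<lambda>_. 2) \<alpha>\<close> is 2 to the total degree of \<open>\<alpha>\<close>.\<close>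

lemma frobenius_monomials_independent:
  fixes K S B :: "'a::comm_ring_1 set"
  assumes "prime p" "CHAR('a) = p" "is_subring S"
    and \<delta>: "\<And>b. b \<in> B \<Longrightarrow> \<exists>\<delta>\<in>Der K. (\<forall>b'\<in>B. \<delta> b' = (if b' = b then 1 else 0)) \<and>
      (\<forall>(F :: ('a \<Rightarrow>\<^sub>0 nat) set) c r. c ` F \<subseteq> S \<longrightarrow> (\<Sum>\<alpha>\<in>F. c \<alpha> * r \<alpha> ^ q) = 0 \<longrightarrow>
        (\<Sum>\<alpha>\<in>F. c \<alpha> * \<delta> (r \<alpha>) ^ q) = 0)"
    and "q > 0" "finite F" "F \<subseteq> reduced_exponents p 1 B" "c ` F \<subseteq> S"
    and "(\<Sum>\<alpha>\<in>F. c \<alpha> * monomial_value \<alpha> ^ q) = 0"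
    and "\<alpha> \<in> F"
  shows "c \<alpha> = 0"
proof -
  let ?d = "mon (\<lambda>_. 2 :: nat)"
  have d_pos: "?d \<alpha> > 0" for \<alpha> :: "'a \<Rightarrow>\<^sub>0 nat" by (simp add: mon_def prod_pos)
  have "finite (?d ` F)" using assms(6) by simp
  then obtain n where "\<And>\<alpha>. \<alpha> \<in> F \<Longrightarrow> ?d \<alpha> \<le> n"
    unfolding finite_nat_set_iff_bounded_le by auto
  then show ?thesis using assms(6-10)
  proof (induction n arbitrary: F c \<alpha>)
    case 0
    then show ?case using d_pos by (metis less_le_not_le)
  next
    case (Suc n)
    \<comment> \<open>Nonzero exponents come first, by differentiating along some \<open>b\<close>
      that occurs; the constant monomial is then alone in the relation.\<close>
    have nz: "c \<alpha> = 0" if "\<alpha> \<in> F" "\<alpha> \<noteq> 0" for \<alpha>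
    proof -
      obtain b where b: "b \<in> Poly_Mapping.keys \<alpha>" using \<open>\<alpha> \<noteq> 0\<close> by fastforce
      have red: "Poly_Mapping.keys \<gamma> \<subseteq> B" "Poly_Mapping.lookup \<gamma> b' < p" if "\<gamma> \<in> F" for \<gamma> b'
        using Suc.prems(3) that by (auto simp: reduced_exponents_def)
      have "b \<in> B" using b red that by blast
      obtain \<delta> where \<delta>: "\<delta> \<in> Der K" "\<And>b'. b' \<in> B \<Longrightarrow> \<delta> b' = (if b' = b then 1 else 0)"
        and rel: "\<And>(F :: ('a \<Rightarrow>\<^sub>0 nat) set) c r. c ` F \<subseteq> S \<Longrightarrow> (\<Sum>\<alpha>\<in>F. c \<alpha> * r \<alpha> ^ q) = 0 \<Longrightarrow>
          (\<Sum>\<alpha>\<in>F. c \<alpha> * \<delta> (r \<alpha>) ^ q) = 0"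
        using assms(4)[OF \<open>b \<in> B\<close>] by blast
      let ?up = "\<lambda>\<beta>. \<beta> + Poly_Mapping.single b (1::nat)"
      \<comment> \<open>\<open>G\<close> and \<open>c'\<close> describe the differentiated relation,
        indexed by the lowered exponents.\<close>
      define G where "G = ?up -` F"
      define c' where "c' \<beta> = c (?up \<beta>) * of_nat (Suc (Poly_Mapping.lookup \<beta> b)) ^ q" for \<beta>
      have inj: "inj ?up" by (simp add: inj_def)
      have G: "finite G" unfolding G_def using Suc.prems(2) inj by (intro finite_vimageI)
      have keys_G: "Poly_Mapping.keys \<beta> \<subseteq> B \<and> (\<forall>b'. Poly_Mapping.lookup \<beta> b' < p)" if "\<beta> \<in> G" for \<beta>
      proof -
        have le: "Poly_Mapping.lookup \<beta> b' \<le> Poly_Mapping.lookup (?up \<beta>) b'" for b'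
          by (simp add: lookup_add)
        then have "Poly_Mapping.keys \<beta> \<subseteq> Poly_Mapping.keys (?up \<beta>)"
          by (metis in_keys_iff le_zero_eq subsetI)
        then show ?thesis using that red[of "?up \<beta>"] le le_less_trans unfolding G_def by blast
      qed
      have dm: "\<delta> (monomial_value (?up \<beta>)) = of_nat (Suc (Poly_Mapping.lookup \<beta> b)) * monomial_value \<beta>"
        if "\<beta> \<in> G" for \<beta>
        unfolding monomial_value_eq_mon
        using \<delta> \<open>b \<in> B\<close> keys_G[OF that] by (intro Der_mon_add_single) auto
      \<comment> \<open>A monomial either contains \<open>b\<close>, so it can be lowered, or is
        killed by \<delta>.\<close>
      have "\<gamma> \<in> ?up ` G \<or> \<delta> (monomial_value \<gamma>) = 0" if "\<gamma> \<in> F" for \<gamma>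
      proof (cases "b \<in> Poly_Mapping.keys \<gamma>")
        case True
        then have "\<gamma> = ?up (\<gamma> - Poly_Mapping.single b 1)"
          by (intro poly_mapping_eqI) (auto simp: lookup_add lookup_minus lookup_single when_def in_keys_iff)
        then show ?thesis using that unfolding G_def by (metis image_eqI vimageI)
      next
        case False
        then show ?thesis
          unfolding monomial_value_eq_mon
          using \<delta> red(1)[OF that] by (intro disjI2 Der_mon_eq_0[OF \<delta>(1)]) auto
      qed
      then have "c \<gamma> * \<delta> (monomial_value \<gamma>) ^ q = 0" if "\<gamma> \<in> F - ?up ` G" for \<gamma>
        using that \<open>q > 0\<close> by (metis DiffE mult_zero_right power_0_left less_irrefl)
      then have "(\<Sum>\<gamma>\<in>F. c \<gamma> * \<delta> (monomial_value \<gamma>) ^ q) = (\<Sum>\<gamma>\<in>?up ` G. c \<gamma> * \<delta> (monomial_value \<gamma>) ^ q)"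
        using Suc.prems(2) by (intro sum.mono_neutral_right) (auto simp: G_def)
      also have "\<dots> = (\<Sum>\<beta>\<in>G. c' \<beta> * monomial_value \<beta> ^ q)"
        using inj_on_subset[OF inj subset_UNIV]
        by (subst sum.reindex) (auto simp: dm c'_def power_mult_distrib mult_ac
            simp del: of_nat_Suc One_nat_def intro!: sum.cong)
      finally have "(\<Sum>\<beta>\<in>G. c' \<beta> * monomial_value \<beta> ^ q) = 0"
        using rel[OF Suc.prems(4,5)] by simp
      moreover have "c' ` G \<subseteq> S"
        using Suc.prems(4) by (auto simp: G_def c'_def simp del: of_nat_Suc
            intro!: is_subring_mult[OF assms(3)] is_subring_power[OF assms(3)] is_subring_of_nat[OF assms(3)])
      \<comment> \<open>Raising the exponent doubles \<open>?d\<close>, so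
        \<open>2 * ?d \<beta> \<le> n + 1\<close> with \<open>?d \<beta>\<close> positive.\<close>
      moreover have "?d \<beta> \<le> n" if "\<beta> \<in> G" for \<beta>
        using Suc.prems(1)[of "?up \<beta>"] that d_pos[of \<beta>] by (simp add: G_def mon_add)
      moreover have "G \<subseteq> reduced_exponents p 1 B"
        using keys_G by (auto simp: reduced_exponents_def)
      ultimately have c'0: "c' \<beta> = 0" if "\<beta> \<in> G" for \<beta>
        using Suc.IH[OF _ G, of c' \<beta>] that by blast
      let ?k = "Poly_Mapping.lookup \<alpha> b"
      have "0 < ?k" using b by (simp add: in_keys_iff)
      have "\<alpha> = ?up (\<alpha> - Poly_Mapping.single b 1)"
        using b by (intro poly_mapping_eqI) (auto simp: lookup_add lookup_minus lookup_single when_def in_keys_iff)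
      then have "c \<alpha> * of_nat ?k ^ q = 0"
        using c'0[of "\<alpha> - Poly_Mapping.single b 1"] \<open>\<alpha> \<in> F\<close> \<open>0 < ?k\<close>
        by (simp add: G_def c'_def lookup_minus del: of_nat_Suc)
      \<comment> \<open>The exponent lies strictly between 0 and \<open>p\<close>, so it is a unit
        and so is its \<open>q\<close>-th power.\<close>
      moreover obtain u :: 'a where "of_nat ?k * u = 1"
        using of_nat_unit_CHAR[OF assms(1,2) \<open>0 < ?k\<close> red(2)[OF \<open>\<alpha> \<in> F\<close>]] by blast
      ultimately show "c \<alpha> = 0"
        by (metis mult.assoc mult.right_neutral mult_zero_left power_mult_distrib power_one)
    qed
    have "c 0 = 0" if "0 \<in> F"
    proof -
      have "(\<Sum>\<alpha>\<in>F. c \<alpha> * monomial_value \<alpha> ^ q) = (\<Sum>\<alpha>\<in>{0}. c \<alpha> * monomial_value \<alpha> ^ q)"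
        using nz that Suc.prems(2) by (intro sum.mono_neutral_right) auto
      then show ?thesis using Suc.prems(5) by (simp add: monomial_value_eq_mon)
    qed
    then show ?case using nz Suc.prems(6) by (cases "\<alpha> = 0") auto
  qed
qed

lemma p_independent_Suc:
  fixes K :: "'a::comm_ring_1 set"
  assumes "prime p" "CHAR('a) = p" "is_subring K" "p_basis p 1 K B" "p_independent p s K B"
    and int: "Der K \<subseteq> IDer K (enat n)" and "p ^ s \<le> n"
  shows "p_independent p (Suc s) K B"
  unfolding p_independent_def
proof (intro allI impI ballI)
  fix F c \<alpha>
  assume "finite F \<and> F \<subseteq> reduced_exponents p (Suc s) B \<and> (\<forall>\<alpha>\<in>F. c \<alpha> \<in> pow_subring p (Suc s) K)
    \<and> (\<Sum>\<alpha>\<in>F. c \<alpha> * monomial_value \<alpha>) = 0"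
  then have F: "finite F" "F \<subseteq> reduced_exponents p (Suc s) B" "\<And>\<alpha>. \<alpha> \<in> F \<Longrightarrow> c \<alpha> \<in> pow_subring p (Suc s) K"
      "(\<Sum>\<alpha>\<in>F. c \<alpha> * monomial_value \<alpha>) = 0" by auto
  assume "\<alpha> \<in> F"
  define q where "q = p ^ s"
  have q: "q > 0" using assms(1) by (simp add: q_def prime_gt_0_nat)
  \<comment> \<open>Division with remainder by \<open>q = p ^ s\<close>: as the exponents are below
    \<open>p * q\<close>, the remainders are reduced at level \<open>s\<close> and the quotients at
    level 1.\<close>
  define lo hi :: "('a \<Rightarrow>\<^sub>0 nat) \<Rightarrow> ('a \<Rightarrow>\<^sub>0 nat)"
    where "lo = Poly_Mapping.map (\<lambda>n. n mod q)" and "hi = Poly_Mapping.map (\<lambda>n. n div q)"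
  have lookup: "Poly_Mapping.lookup (lo \<alpha>) b = Poly_Mapping.lookup \<alpha> b mod q"
      "Poly_Mapping.lookup (hi \<alpha>) b = Poly_Mapping.lookup \<alpha> b div q" for \<alpha> b
    by (auto simp: lo_def hi_def Poly_Mapping.map.rep_eq when_def)
  have keys: "Poly_Mapping.keys (lo \<alpha>) \<subseteq> Poly_Mapping.keys \<alpha>" "Poly_Mapping.keys (hi \<alpha>) \<subseteq> Poly_Mapping.keys \<alpha>" for \<alpha>
    by (auto simp: in_keys_iff lookup intro!: Nat.gr0I)
  have split: "monomial_value \<alpha> = monomial_value (hi \<alpha>) ^ q * monomial_value (lo \<alpha>)" for \<alpha> :: "'a \<Rightarrow>\<^sub>0 nat"
  proof -
    let ?k = "Poly_Mapping.lookup \<alpha>"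
    have "b ^ k = (b ^ (k div q)) ^ q * b ^ (k mod q)" for b :: 'a and k
      by (simp flip: power_mult power_add)
    then have "(\<Prod>b\<in>Poly_Mapping.keys \<alpha>. b ^ ?k b)
        = (\<Prod>b\<in>Poly_Mapping.keys \<alpha>. (b ^ (?k b div q)) ^ q * b ^ (?k b mod q))"
      by (intro prod.cong refl)
    also have "\<dots> = (\<Prod>b\<in>Poly_Mapping.keys \<alpha>. b ^ (?k b div q)) ^ q
        * (\<Prod>b\<in>Poly_Mapping.keys \<alpha>. b ^ (?k b mod q))"
      unfolding prod.distrib prod_power_distrib ..
    finally show ?thesis
      unfolding monomial_value_eq_mon mon_superset[OF finite_keys keys(1)]
        mon_superset[OF finite_keys keys(2)] mon_def[of _ \<alpha>] lookup .
  qed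
  have lo_red: "lo \<gamma> \<in> reduced_exponents p s B" and hi_red: "hi \<gamma> \<in> reduced_exponents p 1 B" if "\<gamma> \<in> F" for \<gamma>
  proof -
    have "Poly_Mapping.keys \<gamma> \<subseteq> B" "\<And>b. Poly_Mapping.lookup \<gamma> b < p * q"
      using F(2) that by (auto simp: reduced_exponents_def q_def)
    then show "lo \<gamma> \<in> reduced_exponents p s B" "hi \<gamma> \<in> reduced_exponents p 1 B"
      using keys[of \<gamma>] q unfolding reduced_exponents_def q_def[symmetric]
      by (auto simp: lookup less_mult_imp_div_less)
  qed
  \<comment> \<open>Collecting terms by remainder gives coefficients of level \<open>s\<close>,
    since the quotients enter only through \<open>q\<close>-th powers; independence at level
    \<open>s\<close> kills each of them.\<close>
  define d where "d \<gamma> = (\<Sum>\<alpha>\<in>{\<alpha>\<in>F. lo \<alpha> = \<gamma>}. c \<alpha> * monomial_value (hi \<alpha>) ^ q)" for \<gamma>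
  have "d \<gamma> \<in> pow_subring p s K" for \<gamma>
    unfolding d_def q_def using F(3) pow_subring_antimono[of s "Suc s" p K]
    by (intro is_subring_sum is_subring_mult power_in_pow_subring) auto
  moreover have "(\<Sum>\<gamma>\<in>lo ` F. d \<gamma> * monomial_value \<gamma>) = 0"
  proof -
    have "c \<alpha> * monomial_value (hi \<alpha>) ^ q * monomial_value (lo \<alpha>) = c \<alpha> * monomial_value \<alpha>" for \<alpha>
      by (simp only: split[of \<alpha>] mult.assoc)
    then have "(\<Sum>\<gamma>\<in>lo ` F. d \<gamma> * monomial_value \<gamma>)
        = (\<Sum>\<gamma>\<in>lo ` F. \<Sum>\<alpha>\<in>{\<alpha>\<in>F. lo \<alpha> = \<gamma>}. c \<alpha> * monomial_value \<alpha>)"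
      unfolding d_def sum_distrib_right by (intro sum.cong refl) auto
    also have "\<dots> = 0" using sum.image_gen[OF F(1), of "\<lambda>\<alpha>. c \<alpha> * monomial_value \<alpha>" lo] F(4) by simp
    finally show ?thesis .
  qed
  ultimately have "\<forall>\<gamma>\<in>lo ` F. d \<gamma> = 0"
    using assms(5) F(1) lo_red unfolding p_independent_def
    by (metis (no_types, lifting) finite_imageI image_subsetI)
  then have d0: "d (lo \<alpha>) = 0" using \<open>\<alpha> \<in> F\<close> by blast
  let ?G = "{\<beta>\<in>F. lo \<beta> = lo \<alpha>}"
  \<comment> \<open>Within one remainder class the quotient determines the exponent function, so
    \<open>d (lo \<alpha>) = 0\<close> can be indexed by quotients.\<close>
  have inj: "inj_on hi ?G"
  proof (rule inj_onI, rule poly_mapping_eqI)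
    fix \<beta> \<gamma> b assume "\<beta> \<in> ?G" "\<gamma> \<in> ?G" "hi \<beta> = hi \<gamma>"
    then show "Poly_Mapping.lookup \<beta> b = Poly_Mapping.lookup \<gamma> b"
      using lookup by (metis (mono_tags, lifting) div_mult_mod_eq mem_Collect_eq)
  qed
  define c' where "c' = c \<circ> the_inv_into ?G hi"
  have c': "c' (hi \<beta>) = c \<beta>" if "\<beta> \<in> ?G" for \<beta>
    using the_inv_into_f_f[OF inj that] by (simp add: c'_def)
  have "c' (hi \<alpha>) = 0"
  proof (rule frobenius_monomials_independent[OF assms(1,2) is_subring_pow_subring,
        where B = B and K = K and q = q and F = "hi ` ?G"])
    fix b assume "b \<in> B"
    obtain \<delta> where \<delta>: "\<delta> \<in> Der K" "\<forall>b'\<in>B. \<delta> b' = (if b' = b then 1 else 0)"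
      using p_basis_derivation[OF assms(1,2,4)] by blast
    obtain E where E: "E \<in> HS K (enat n)" "E 1 = \<delta>"
      using \<delta>(1) int by (auto simp: IDer_def)
    show "\<exists>\<delta>\<in>Der K. (\<forall>b'\<in>B. \<delta> b' = (if b' = b then 1 else 0)) \<and>
      (\<forall>(F :: ('a \<Rightarrow>\<^sub>0 nat) set) c r. c ` F \<subseteq> pow_subring p (Suc s) K \<longrightarrow> (\<Sum>\<alpha>\<in>F. c \<alpha> * r \<alpha> ^ q) = 0 \<longrightarrow>
        (\<Sum>\<alpha>\<in>F. c \<alpha> * \<delta> (r \<alpha>) ^ q) = 0)"
    proof (intro bexI[OF _ \<delta>(1)] conjI \<delta>(2) allI impI)
      fix F :: "('a \<Rightarrow>\<^sub>0 nat) set" and c r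
      assume "c ` F \<subseteq> pow_subring p (Suc s) K" "(\<Sum>\<alpha>\<in>F. c \<alpha> * r \<alpha> ^ q) = 0"
      then show "(\<Sum>\<alpha>\<in>F. c \<alpha> * \<delta> (r \<alpha>) ^ q) = 0"
        using HS_frobenius_relation[OF assms(1-3) E(1) q_def, of F c r] assms(7) E(2)
        by (simp only: q_def image_subset_iff)
    qed
  next
    show "c' ` hi ` ?G \<subseteq> pow_subring p (Suc s) K" using c' F(3) by auto
    show "(\<Sum>\<alpha>\<in>hi ` ?G. c' \<alpha> * monomial_value \<alpha> ^ q) = 0"
      using d0 c' by (simp add: d_def sum.reindex[OF inj])
  qed (use q F(1) hi_red \<open>\<alpha> \<in> F\<close> in auto)
  then show "c \<alpha> = 0" using c' \<open>\<alpha> \<in> F\<close> by simp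
qed

text \<open>Induction from the given \<open>p\<close>-basis, keeping the same set \<open>B\<close>.
  Passing from level \<open>k < e\<close> to \<open>k + 1\<close> needs integrals of length
  \<open>p ^ k\<close>, which is at most \<open>p ^ e - 1\<close>.\<close>

lemma p_basis_of_integrable:
  fixes K :: "'a::comm_ring_1 set"
  assumes "prime p" "CHAR('a) = p" "is_subring K" "p_basis p 1 K B"
    and "Der K \<subseteq> IDer K (enat (p ^ e - 1))" and "1 \<le> s" "s \<le> e"
  shows "p_basis p s K B"
  using assms(6,7)
proof (induction s rule: dec_induct)
  case (step k)
  then have "p ^ k < p ^ e"
    using prime_gt_1_nat[OF assms(1)] by (intro power_strict_increasing) auto
  then have "p ^ k \<le> p ^ e - 1" by simp
  then show ?case
    using step assms(4) p_independent_Suc[OF assms(1-4) _ assms(5), of k]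
      hull_pow_subring_Suc[OF assms(1,2), of K B k]
    by (simp add: p_basis_def)
qed (use assms(4) in simp)

lemma Der_eq_IDer_of_HS_eq_IHS:
  assumes "HS K (enat 1) = IHS K (enat 1) n"
  shows "Der K = IDer K n"
proof -
  have "\<exists>E\<in>HS K n. E 1 = \<delta>" if \<delta>: "\<delta> \<in> Der K" for \<delta>
  proof -
    \<comment> \<open>A derivation is the same as a Hasse-Schmidt derivation of length 1 with
      entries \<open>id\<close> and \<delta>.\<close>
    let ?D = "restrict (\<lambda>i. if i = 0 then id else \<delta>) {i. enat i \<le> enat 1}"
    have 01: "enat i \<le> enat 1 \<longleftrightarrow> i = 0 \<or> i = 1" for i by auto
    have "?D \<in> HS K (enat 1)"
      using \<delta> unfolding HS_def Der_def linear_over_def 01 by auto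
    then obtain E where E: "E \<in> HS K n" "truncation (enat 1) E = ?D"
      using assms unfolding IHS_def by blast
    have "truncation (enat 1) E 1 = ?D 1" by (simp only: E(2))
    then show ?thesis using E(1) by (auto simp: truncation_def)
  qed
  then show ?thesis by (auto simp: IDer_def)
qed

theorem theorem3p4:
  fixes p e :: nat and K :: "'a::comm_ring_1 set"
  assumes "prime p" and "CHAR('a) = p" and "e \<ge> 1"
    and "is_subring K" and "\<exists>B. p_basis p 1 K B"
  shows "((\<exists>B. p_basis p e K B) \<longleftrightarrow> (\<forall>s. 1 \<le> s \<and> s \<le> e \<longrightarrow> (\<exists>B. p_basis p s K B)))
    \<and> ((\<forall>s. 1 \<le> s \<and> s \<le> e \<longrightarrow> (\<exists>B. p_basis p s K B)) \<longleftrightarrow> Der K = IDer K (enat (p ^ e - 1)))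
    \<and> (Der K = IDer K (enat (p ^ e - 1)) \<longleftrightarrow>
        (\<forall>m::nat. 1 \<le> m \<and> m \<le> p ^ e - 1 \<longrightarrow> HS K (enat m) = IHS K (enat m) (enat (p ^ e - 1))))"
proof -
  obtain B\<^sub>0 where B\<^sub>0: "p_basis p 1 K B\<^sub>0" using assms(5) by blast
  let ?n = "p ^ e - 1"
  have "p ^ 1 \<le> p ^ e" using assms(1,3) by (intro power_increasing) (auto simp: prime_gt_0_nat Suc_leI)
  then have n: "1 \<le> ?n" using prime_ge_2_nat[OF assms(1)] by simp
  \<comment> \<open>The implications run in the cycle (1), (4), (3), (2), (1).\<close>
  have 1: "\<forall>m::nat. 1 \<le> m \<and> m \<le> ?n \<longrightarrow> HS K (enat m) = IHS K (enat m) (enat ?n)"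
    if "\<exists>B. p_basis p e K B"
    using that p_basis_integrable[OF assms(1,2,4)] by blast
  have 2: "Der K = IDer K (enat ?n)"
    if "\<forall>m::nat. 1 \<le> m \<and> m \<le> ?n \<longrightarrow> HS K (enat m) = IHS K (enat m) (enat ?n)"
    using that n by (intro Der_eq_IDer_of_HS_eq_IHS) auto
  have 3: "\<forall>s. 1 \<le> s \<and> s \<le> e \<longrightarrow> (\<exists>B. p_basis p s K B)" if "Der K = IDer K (enat ?n)"
    using p_basis_of_integrable[OF assms(1,2,4) B\<^sub>0] that by blast
  have 4: "\<exists>B. p_basis p e K B" if "\<forall>s. 1 \<le> s \<and> s \<le> e \<longrightarrow> (\<exists>B. p_basis p s K B)"
    using that assms(3) by blast
  show ?thesis using 1 2 3 4 by blast
qed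

end
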